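(* Let $p$ be an odd prime. Then, in the polynomial ring $\mathbb{Z}[q]$, $$q^{(p^2-1)/8}\,\mathcal{P}_p(q)\equiv \Big(\tfrac{2}{p}\Big)\pmod{[p]_q},\qquad \widehat{\mathcal{P}}_p(q)\equiv \Big(\tfrac{2}{p}\Big)q^{(p^2-1)/8}\pmod{[p]_q},$$ and $$\mathcal{P}_{p+1}(q)-\mathcal{P}_p(q)\equiv \widehat{\mathcal{P}}_{p+1}(q)-\widehat{\mathcal{P}}_p(q)\equiv 1\pmod{[p]_q}.$$
   Context: The $q$-Pell polynomials are defined by $\mathcal{P}_0(q)=0$, $\mathcal{P}_1(q)=1$, $\mathcal{P}_n(q)=(1+q^{n-1})\mathcal{P}_{n-1}(q)+q^{n-2}\mathcal{P}_{n-2}(q)$ for $n\ge 2$; and $\widehat{\mathcal{P}}_0(q)=0$, $\widehat{\mathcal{P}}_1(q)=1$, $\widehat{\mathcal{P}}_n(q)=(1+q^{n-1})\widehat{\mathcal{P}}_{n-1}(q)+q^{n-1}\widehat{\mathcal{P}}_{n-2}(q)$ for $n\ge 2$. For a non-negative integer $n$, $[n]_q=\frac{1-q^n}{1-q}=1+q+\cdots+q^{n-1}$. $\big(\tfrac{\cdot}{p}\big)$ denotes the Legendre symbol. A congruence $f\equiv g\pmod{h}$ of polynomials means $h$ divides $f-g$ in $\mathbb{Z}[q]$. *)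

theory Defs
  imports
    "HOL-Computational_Algebra.Polynomial"
    "HOL-Computational_Algebra.Primes"
    "HOL-Number_Theory.Residues"
begin

abbreviation q :: "int poly" where
  "q \<equiv> [:0, 1:]"

text \<open>In both recursions the equation for \<open>Suc (Suc n)\<close> is the recurrence at index \<open>n + 2\<close>,
  so the exponents of \<open>q\<close> are shifted by two.\<close>

fun q_pell :: "nat \<Rightarrow> int poly" where
  "q_pell 0 = 0"
| "q_pell (Suc 0) = 1"
| "q_pell (Suc (Suc n)) =
     (1 + q ^ (n + 1)) * q_pell (Suc n) + q ^ n * q_pell n"

fun q_pell_hat :: "nat \<Rightarrow> int poly" where
  "q_pell_hat 0 = 0"
| "q_pell_hat (Suc 0) = 1"
| "q_pell_hat (Suc (Suc n)) =
     (1 + q ^ (n + 1)) * q_pell_hat (Suc n) + q ^ (n + 1) * q_pell_hat n"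

definition q_bracket :: "nat \<Rightarrow> int poly" where
  "q_bracket n = (\<Sum>k<n. q ^ k)"

lemma one_minus_q_times_q_bracket: "(1 - q) * q_bracket n = 1 - q ^ n"
  unfolding q_bracket_def by (rule one_diff_power_eq [symmetric])

text \<open>The library's \<^const>\<open>cong\<close> requires a Euclidean semiring, which \<open>\<int>[q]\<close> is not.\<close>

definition poly_cong :: "int poly \<Rightarrow> int poly \<Rightarrow> int poly \<Rightarrow> bool"
    ("(1[_ \<equiv> _] '(pmod _'))") where
  "[f \<equiv> g] (pmod h) \<longleftrightarrow> h dvd f - g"

end

theory Submission
  imports Defs Complex_Main "HOL-Number_Theory.Gauss"
begin

text \<open>Divisibility by \<open>[p]\<close> can be tested at the nontrivial \<open>p\<close>-th roots of unity \<open>z\<close>. Both sequences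
  satisfy \<open>X (n + 2) = (1 + z ^ (n + 1)) * X (n + 1) + t * z ^ n * X n\<close>, with \<open>t = 1\<close> and \<open>t = z\<close>
  respectively, and such a sequence has an explicit expansion as a sum of \<open>q\<close>-hypergeometric terms.
  With \<open>p = 2 * N + 1\<close>, the terms of \<open>X p\<close> at \<open>z\<close> collapse to
  \<open>t ^ i * z ^ (i\<^sup>2)\<close> times a Gaussian binomial coefficient in base \<open>z\<^sup>2\<close>, so that the finite binomial
  theorem gives \<open>X p = (\<Prod>j<N. 1 + t * z ^ (2 * j + 1))\<close>. Gauss's lemma, applied to the odd periodic
  function \<open>x \<mapsto> z ^ x - z ^ (- x)\<close>, evaluates these products by the Legendre symbol of 2.\<close>

section \<open>Evaluation of integer polynomials at complex numbers\<close>

definition eval_complex :: "complex \<Rightarrow> int poly \<Rightarrow> complex" where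
  "eval_complex z f = poly (map_poly of_int f) z"

lemma eval_complex_0 [simp]: "eval_complex z 0 = 0"
  by (simp add: eval_complex_def)

lemma eval_complex_pCons [simp]: "eval_complex z (pCons c f) = of_int c + z * eval_complex z f"
  by (simp add: eval_complex_def map_poly_pCons)

lemma eval_complex_1 [simp]: "eval_complex z 1 = 1"
  by (simp add: one_pCons)

lemma eval_complex_add [simp]: "eval_complex z (f + g) = eval_complex z f + eval_complex z g"
proof -
  have "map_poly of_int (f + g) = map_poly of_int f + (map_poly of_int g :: complex poly)"
    by (rule poly_eqI) (simp add: coeff_map_poly)
  then show ?thesis by (simp add: eval_complex_def)
qed

lemma eval_complex_smult [simp]: "eval_complex z (Polynomial.smult c f) = of_int c * eval_complex z f"
  by (simp add: eval_complex_def map_poly_smult)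

lemma eval_complex_diff [simp]: "eval_complex z (f - g) = eval_complex z f - eval_complex z g"
proof -
  have "eval_complex z (f - g) + eval_complex z g = eval_complex z f" by (simp flip: eval_complex_add)
  then show ?thesis by (simp add: algebra_simps)
qed

lemma eval_complex_mult [simp]: "eval_complex z (f * g) = eval_complex z f * eval_complex z g"
  by (induction f) (simp_all add: algebra_simps)

lemma eval_complex_power [simp]: "eval_complex z (f ^ n) = eval_complex z f ^ n"
  by (induction n) simp_all

lemma eval_complex_of_int [simp]: "eval_complex z (of_int c) = of_int c"
  by (simp add: of_int_poly)

lemma eval_complex_q_bracket:
  assumes "z ^ n = 1" "z \<noteq> 1"
  shows "eval_complex z (q_bracket n) = 0"
proof -
  have "(1 - z) * eval_complex z (q_bracket n) = eval_complex z ((1 - q) * q_bracket n)" by simp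
  also have "\<dots> = 0" unfolding one_minus_q_times_q_bracket using assms by simp
  finally show ?thesis using assms by simp
qed

lemma coeff_q_bracket: "Polynomial.coeff (q_bracket n) k = (if k < n then 1 else 0)"
proof -
  have "q ^ j = Polynomial.monom 1 j" for j by (simp add: monom_altdef)
  then show ?thesis by (simp add: q_bracket_def coeff_sum)
qed

text \<open>Since \<open>q_bracket n\<close> is monic, division with remainder stays in Z[q]. The
  remainder has degree below n - 1 but vanishes at the n - 1 nontrivial n-th roots of unity, so it
  is 0.\<close>

lemma q_bracket_dvd:
  assumes n: "n > 0" and vanish: "\<And>z. z ^ n = 1 \<Longrightarrow> z \<noteq> 1 \<Longrightarrow> eval_complex z f = 0"
  shows "q_bracket n dvd f"
proof -
  let ?g = "q_bracket n"
  have deg: "degree ?g = n - 1"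
    using n by (intro antisym degree_le le_degree) (auto simp: coeff_q_bracket)
  have lead: "lead_coeff ?g = 1" using n by (simp add: deg coeff_q_bracket)
  then have g0: "?g \<noteq> 0" by auto
  \<comment> \<open>Pseudo-division scales \<open>f\<close> by a power of the leading coefficient,
    which is 1 here, so it is genuine division.\<close>
  obtain s r where sr: "pseudo_divmod f ?g = (s, r)" by fastforce
  have f: "f = ?g * s + r"
    using pseudo_divmod(1)[OF g0 sr] by (simp add: lead)
  have r: "r = 0 \<or> degree r < n - 1"
    using pseudo_divmod(2)[OF g0 sr] by (simp add: deg)
  have "r = 0"
  proof (rule ccontr)
    assume "r \<noteq> 0"
    define R :: "complex poly" where "R = map_poly of_int r"
    have "degree R < n - 1" using r \<open>r \<noteq> 0\<close> by (simp add: R_def degree_map_poly)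
    moreover have "R \<noteq> 0" using \<open>r \<noteq> 0\<close> by (simp add: R_def map_poly_eq_0_iff)
    moreover have "{z. z ^ n = 1} - {1} \<subseteq> {z. poly R z = 0}"
    proof
      fix z :: complex assume "z \<in> {z. z ^ n = 1} - {1}"
      then have z: "z ^ n = 1" "z \<noteq> 1" by auto
      have "eval_complex z f = eval_complex z ?g * eval_complex z s + eval_complex z r" by (subst f) simp
      then show "z \<in> {z. poly R z = 0}"
        using vanish[OF z] eval_complex_q_bracket[OF z] by (simp add: R_def eval_complex_def)
    qed
    then have "card ({z::complex. z ^ n = 1} - {1}) \<le> card {z. poly R z = 0}"
      using \<open>R \<noteq> 0\<close> by (intro card_mono poly_roots_finite)
    moreover have "card ({z::complex. z ^ n = 1} - {1}) = n - 1"
      using n by (subst card_Diff_subset) (auto simp: card_roots_unity_eq)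
    ultimately show False using card_poly_roots_bound[of R] by linarith
  qed
  then show ?thesis using f by simp
qed

text \<open>By Bezout, k is invertible modulo p, so z^k = 1 would force z = 1. This keeps the
  q-factorials in the denominators nonzero.\<close>

lemma prime_root_of_unity_power_neq_1:
  fixes z :: "'a :: field"
  assumes "prime p" "z ^ p = 1" "z \<noteq> 1" "0 < k" "k < p"
  shows "z ^ k \<noteq> 1"
proof
  assume k: "z ^ k = 1"
  have "coprime k p"
    using assms by (metis coprime_commute nat_dvd_not_less prime_imp_coprime)
  then obtain x y where "k * x = p * y + 1"
    using bezout_nat[of k p] \<open>0 < k\<close> by auto
  then have "z ^ (k * x) = z ^ (p * y) * z" by simp
  then show False using k assms by (simp add: power_mult)
qed

section \<open>Explicit formula for the Pell-type recurrences\<close>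

text \<open>The q-Pochhammer symbol (z; z)_n.\<close>

definition qfac :: "'a :: field \<Rightarrow> nat \<Rightarrow> 'a" where
  "qfac z n = (\<Prod>j<n. 1 - z ^ Suc j)"

lemma qfac_0 [simp]: "qfac z 0 = 1"
  by (simp add: qfac_def)

lemma qfac_Suc: "qfac z (Suc n) = qfac z n * (1 - z ^ Suc n)"
  by (simp add: qfac_def)

lemma qfac_nonzero: "(\<And>k. 0 < k \<Longrightarrow> k \<le> n \<Longrightarrow> z ^ k \<noteq> 1) \<Longrightarrow> qfac z n \<noteq> 0"
  by (auto simp: qfac_def simp del: power_Suc)

lemma qfac_even: "qfac z (2 * m) = qfac (z\<^sup>2) m * (\<Prod>j<m. 1 - z ^ (2 * j + 1))"
proof (induction m)
  case (Suc m)
  have "z ^ Suc (Suc (2 * m)) = (z\<^sup>2) ^ Suc m"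
    by (simp only: power_mult[symmetric]) simp
  then have "qfac z (2 * Suc m) = qfac z (2 * m) * (1 - z ^ (2 * m + 1)) * (1 - (z\<^sup>2) ^ Suc m)"
    by (simp add: qfac_Suc del: power_Suc)
  then show ?case using Suc by (simp add: qfac_Suc[of "z\<^sup>2"] mult_ac del: power_Suc)
qed simp

text \<open>With \<open>m = n - 2 * i\<close> this is \<open>t ^ i * z ^ (i\<^sup>2)\<close> times the Gaussian binomial of \<open>n - i\<close> over \<open>i\<close>
  in base \<open>z\<close> times \<open>(1 + z ^ (i + 1)) \<cdots> (1 + z ^ (n - i))\<close>.\<close>

definition pell_term :: "'a :: field \<Rightarrow> 'a \<Rightarrow> nat \<Rightarrow> nat \<Rightarrow> 'a" where
  "pell_term t z m i = t ^ i * z ^ (i\<^sup>2) * qfac (z\<^sup>2) (m + i) / (qfac (z\<^sup>2) i * qfac z m)"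

lemma pell_term_Suc_left:
  assumes "z ^ Suc m \<noteq> 1"
  shows "pell_term t z (Suc m) i * (1 - z ^ Suc m) = pell_term t z m i * (1 - z ^ (2 * (m + i + 1)))"
proof -
  have "1 - z ^ Suc m \<noteq> 0" using assms by simp
  moreover have "qfac (z\<^sup>2) (Suc m + i) = qfac (z\<^sup>2) (m + i) * (1 - z ^ (2 * (m + i + 1)))"
    by (simp only: add_Suc qfac_Suc power_mult[symmetric]) simp
  ultimately show ?thesis
    by (simp add: pell_term_def qfac_Suc[of z] del: power_Suc)
qed

lemma pell_term_0:
  assumes "z ^ Suc m \<noteq> 1"
  shows "pell_term t z (Suc m) 0 = (1 + z ^ Suc m) * pell_term t z m 0"
proof -
  have "pell_term t z (Suc m) 0 * (1 - z ^ Suc m)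
      = (1 + z ^ Suc m) * pell_term t z m 0 * (1 - z ^ Suc m)"
    by (subst pell_term_Suc_left[OF assms])
      (simp add: power_mult power2_eq_square algebra_simps power_mult_distrib)
  then show ?thesis using assms by (simp del: power_Suc)
qed

text \<open>Trading a unit of m for a unit of i preserves m + i, so the numerators agree; the rest
  comes from the denominators and (i + 1)^2 - i^2 = 2i + 1.\<close>

lemma pell_term_shift:
  assumes "z ^ Suc m \<noteq> 1" "(z\<^sup>2) ^ Suc i \<noteq> 1"
  shows "pell_term t z m (Suc i) * (1 - (z\<^sup>2) ^ Suc i)
    = t * z ^ (2 * i + 1) * (1 - z ^ Suc m) * pell_term t z (Suc m) i"
proof -
  have "1 - z ^ Suc m \<noteq> 0" "1 - (z\<^sup>2) ^ Suc i \<noteq> 0" using assms by simp_all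
  moreover have "z ^ ((Suc i)\<^sup>2) = z ^ (i\<^sup>2) * z ^ (2 * i + 1)"
    unfolding power_add[symmetric] by (rule arg_cong) (simp add: power2_eq_square)
  ultimately show ?thesis
    by (simp add: pell_term_def qfac_Suc[of z m] qfac_Suc[of "z\<^sup>2" i] power_Suc[of t] del: power_Suc)
qed

text \<open>With n = m + 2i + 3 the three terms belong to the levels n, n - 1 and n - 2: the
  recurrence holds summand by summand.\<close>

lemma pell_term_Suc:
  assumes m: "z ^ Suc m \<noteq> 1" and i: "(z\<^sup>2) ^ Suc i \<noteq> 1"
  shows "pell_term t z (Suc m) (Suc i)
    = (1 + z ^ (m + 2 * i + 3)) * pell_term t z m (Suc i) + t * z ^ (m + 2 * i + 2) * pell_term t z (Suc m) i"
proof -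
  define a where "a = z ^ m"
  define b where "b = z ^ i"
  define x where "x = pell_term t z m (Suc i)"
  define y where "y = pell_term t z (Suc m) i"
  have L: "pell_term t z (Suc m) (Suc i) * (1 - z * a) = x * (1 - a\<^sup>2 * b\<^sup>2 * z ^ 4)"
    using pell_term_Suc_left[OF m, of t "Suc i"]
    by (simp add: a_def b_def x_def y_def power_mult_distrib power_add power_mult eval_nat_numeral algebra_simps)
  have S: "x * (1 - z\<^sup>2 * b\<^sup>2) = t * (b\<^sup>2 * z) * (1 - z * a) * y"
    using pell_term_shift[OF m i, of t]
    by (simp add: a_def b_def x_def y_def power_mult_distrib power_add power_mult eval_nat_numeral algebra_simps)
  \<comment> \<open>\<open>S\<close> turns the y part into a multiple of x. What remains is (1 + a
    b^2 z^3)(1 - z a) + a z (1 - z^2 b^2) = 1 - a^2 b^2 z^4.\<close>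
  have "(x * (1 + a * b\<^sup>2 * z ^ 3) + t * (a * b\<^sup>2 * z\<^sup>2) * y) * (1 - z * a)
      = x * (1 + a * b\<^sup>2 * z ^ 3) * (1 - z * a) + a * z * (t * (b\<^sup>2 * z) * (1 - z * a) * y)"
    by (simp add: algebra_simps eval_nat_numeral)
  also have "\<dots> = x * (1 - a\<^sup>2 * b\<^sup>2 * z ^ 4)"
    unfolding S[symmetric] by (simp add: algebra_simps eval_nat_numeral)
  finally have "(x * (1 + a * b\<^sup>2 * z ^ 3) + t * (a * b\<^sup>2 * z\<^sup>2) * y) * (1 - z * a)
      = pell_term t z (Suc m) (Suc i) * (1 - z * a)"
    using L by simp
  moreover have "1 - z * a \<noteq> 0" using m by (simp add: a_def)
  ultimately have "pell_term t z (Suc m) (Suc i) = x * (1 + a * b\<^sup>2 * z ^ 3) + t * (a * b\<^sup>2 * z\<^sup>2) * y"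
    by simp
  moreover have "z ^ (m + 2 * i + 3) = a * b\<^sup>2 * z ^ 3" "z ^ (m + 2 * i + 2) = a * b\<^sup>2 * z\<^sup>2"
    unfolding a_def b_def power_mult[symmetric] power_add[symmetric] by (simp_all add: mult.commute)
  ultimately show ?thesis by (simp add: x_def y_def algebra_simps)
qed

text \<open>The guard excludes spurious terms from the truncated subtraction, so sums may run past
  n/2.\<close>

definition pell_summand :: "'a :: field \<Rightarrow> 'a \<Rightarrow> nat \<Rightarrow> nat \<Rightarrow> 'a" where
  "pell_summand t z n i = (if 2 * i \<le> n then pell_term t z (n - 2 * i) i else 0)"

lemma pell_summand_Suc_Suc:
  assumes nz: "\<And>k. 0 < k \<Longrightarrow> k \<le> Suc (Suc n) \<Longrightarrow> z ^ k \<noteq> 1"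
  shows "pell_summand t z (Suc (Suc n)) (Suc i)
    = (1 + z ^ (n + 2)) * pell_summand t z (Suc n) (Suc i) + t * z ^ (n + 1) * pell_summand t z n i"
proof -
  consider "2 * i > n" | "2 * i = n" | m where "n = m + 2 * i + 1"
    by (metis add.commute add_Suc_right less_iff_Suc_add linorder_neqE_nat plus_1_eq_Suc)
  then show ?thesis
  proof cases
    case 1 then show ?thesis by (simp add: pell_summand_def)
  next
    \<comment> \<open>At this boundary the middle summand is out of range, and the two ratio lemmas
      at m = 0 relate the outer ones.\<close>
    case 2
    have "(z\<^sup>2) ^ Suc i \<noteq> 1" unfolding power_mult[symmetric] by (rule nz) (use 2 in auto)
    moreover have "z ^ Suc 0 \<noteq> 1" by (rule nz) auto
    moreover have "z ^ (2 * (0 + i + 1)) = (z\<^sup>2) ^ Suc i" by (simp only: power_mult[symmetric]) simp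
    ultimately have "pell_term t z 0 (Suc i) * (1 - (z\<^sup>2) ^ Suc i)
        = t * z ^ (2 * i + 1) * pell_term t z 0 i * (1 - (z\<^sup>2) ^ Suc i)"
      using pell_term_shift[of z 0 i t] pell_term_Suc_left[of z 0 t i]
      by (simp add: mult.commute[of "1 - z"] del: power_Suc)
    then have "pell_term t z 0 (Suc i) = t * z ^ (2 * i + 1) * pell_term t z 0 i"
      using \<open>(z\<^sup>2) ^ Suc i \<noteq> 1\<close> by (simp del: power_Suc)
    then show ?thesis using 2 by (simp add: pell_summand_def)
  next
    case 3
    have "(z\<^sup>2) ^ Suc i \<noteq> 1" unfolding power_mult[symmetric] by (rule nz) (use 3 in auto)
    moreover have "z ^ Suc m \<noteq> 1" using nz[of "Suc m"] 3 by simp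
    ultimately show ?thesis
      using pell_term_Suc[of z m i t] 3 by (simp add: pell_summand_def add_ac numeral_eq_Suc)
  qed
qed

text \<open>The summand at 0 follows \<open>pell_term_0\<close>, all later ones
  \<open>pell_summand_Suc_Suc\<close>. The condition stops at k = n so that z may be a root of unity
  of order n + 1.\<close>

lemma pell_explicit:
  fixes X :: "nat \<Rightarrow> 'a :: field"
  assumes X: "X 0 = 0" "X 1 = 1"
    "\<And>n. X (Suc (Suc n)) = (1 + z ^ (n + 1)) * X (Suc n) + t * z ^ n * X n"
    and nz: "\<And>k. 0 < k \<Longrightarrow> k \<le> n \<Longrightarrow> z ^ k \<noteq> 1"
  shows "X (Suc n) = (\<Sum>i\<le>n. pell_summand t z n i)"
  using nz
proof (induction n rule: induct_nat_012)
  case 0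
  then show ?case using X by (simp add: pell_summand_def pell_term_def)
next
  case 1
  have "z \<noteq> 1" using 1[of 1] by simp
  then show ?case using X(1,2) X(3)[of 0] pell_term_0[of z 0 t]
    by (simp add: pell_summand_def) (simp add: pell_term_def)
next
  case (ge2 n)
  have "(\<Sum>i\<le>Suc (Suc n). pell_summand t z (Suc (Suc n)) i)
      = pell_summand t z (Suc (Suc n)) 0 + (\<Sum>i\<le>Suc n. pell_summand t z (Suc (Suc n)) (Suc i))"
    by (rule sum.atMost_Suc_shift)
  also have "pell_summand t z (Suc (Suc n)) 0 = (1 + z ^ (n + 2)) * pell_summand t z (Suc n) 0"
    using pell_term_0[of z "Suc n" t] ge2.prems[of "Suc (Suc n)"] by (simp add: pell_summand_def)
  also have "(\<Sum>i\<le>Suc n. pell_summand t z (Suc (Suc n)) (Suc i))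
      = (1 + z ^ (n + 2)) * (\<Sum>i\<le>Suc n. pell_summand t z (Suc n) (Suc i))
        + t * z ^ (n + 1) * (\<Sum>i\<le>Suc n. pell_summand t z n i)"
    by (simp only: pell_summand_Suc_Suc[OF ge2.prems] sum.distrib sum_distrib_left)
  \<comment> \<open>The extra index i = n + 1 contributes 0, so the induction hypothesis
    applies.\<close>
  also have "(\<Sum>i\<le>Suc n. pell_summand t z n i) = X (Suc n)"
    using ge2 by (simp add: pell_summand_def)
  also have "(1 + z ^ (n + 2)) * pell_summand t z (Suc n) 0
        + ((1 + z ^ (n + 2)) * (\<Sum>i\<le>Suc n. pell_summand t z (Suc n) (Suc i)) + t * z ^ (n + 1) * X (Suc n))
      = (1 + z ^ (n + 2)) * (\<Sum>i\<le>Suc (Suc n). pell_summand t z (Suc n) i) + t * z ^ (n + 1) * X (Suc n)"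
    unfolding sum.atMost_Suc_shift[of _ "Suc n"] by (simp only: algebra_simps)
  also have "(\<Sum>i\<le>Suc (Suc n). pell_summand t z (Suc n) i) = X (Suc (Suc n))"
    using ge2 by (simp add: pell_summand_def)
  finally show ?case using X(3)[of "Suc n"] by simp
qed

section \<open>The finite binomial theorem\<close>

definition qbinom :: "'a :: field \<Rightarrow> nat \<Rightarrow> nat \<Rightarrow> 'a" where
  "qbinom z n i = (if i \<le> n then qfac z n / (qfac z i * qfac z (n - i)) else 0)"

text \<open>A q-Pascal rule: for n - i = m + 1, the two parts of 1 - z^(n+1) = (1 - z^(m+1)) +
  z^(m+1) (1 - z^(i+1)) yield the two binomials. The value 0 beyond n covers i = n.\<close>

lemma qbinom_Suc_Suc:
  assumes nz: "qfac z (Suc n) \<noteq> 0" and "i \<le> n"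
  shows "qbinom z (Suc n) (Suc i) = qbinom z n (Suc i) + z ^ (n - i) * qbinom z n i"
proof -
  have nonzero: "z ^ Suc k \<noteq> 1" "qfac z k \<noteq> 0" if "k \<le> n" for k
    using nz that by (fastforce simp: qfac_def less_Suc_eq_le simp del: power_Suc prod.lessThan_Suc)+
  show ?thesis
  proof (cases "i = n")
    case True
    then show ?thesis using nz by (simp add: qbinom_def nonzero)
  next
    case False
    then obtain m where n: "n = Suc (m + i)"
      using \<open>i \<le> n\<close> by (metis add.commute le_neq_implies_less less_iff_Suc_add)
    \<comment> \<open>Here u and v stand for 1 - z^(m+1) and 1 - z^(i+1), a for z^(m+1), and M, I, Q
      for the q-factorials of m, i, n.\<close>
    have partial_fractions: "Q * (u + a * v) / (I * v * (M * u)) = Q / (I * v * M) + a * (Q / (I * (M * u)))"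
      if "u \<noteq> 0" "v \<noteq> 0" "M \<noteq> 0" "I \<noteq> 0" for Q u v a I M :: 'a
      using that by (simp add: field_simps)
    have factors: "1 - z ^ Suc m \<noteq> 0" "1 - z ^ Suc i \<noteq> 0" "qfac z m \<noteq> 0" "qfac z i \<noteq> 0"
      using nonzero[of m] nonzero[of i] n by auto
    have "z ^ Suc n = z ^ Suc m * z ^ Suc i"
      unfolding power_add[symmetric] by (simp add: n)
    then have split: "1 - z ^ Suc n = (1 - z ^ Suc m) + z ^ Suc m * (1 - z ^ Suc i)"
      by (simp add: right_diff_distrib del: power_Suc)
    have d: "Suc n - Suc i = Suc m" "n - Suc i = m" "n - i = Suc m" using n by simp_all
    have eq1: "qbinom z (Suc n) (Suc i) = qfac z n * ((1 - z ^ Suc m) + z ^ Suc m * (1 - z ^ Suc i))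
        / (qfac z i * (1 - z ^ Suc i) * (qfac z m * (1 - z ^ Suc m)))"
      unfolding qbinom_def d qfac_Suc split using \<open>i \<le> n\<close> by simp
    have eq2: "qbinom z n (Suc i) = qfac z n / (qfac z i * (1 - z ^ Suc i) * qfac z m)"
      unfolding qbinom_def d qfac_Suc[of z i] using n by simp
    have eq3: "qbinom z n i = qfac z n / (qfac z i * (qfac z m * (1 - z ^ Suc m)))"
      unfolding qbinom_def d qfac_Suc[of z m] using n by simp
    show ?thesis
      unfolding eq1 eq2 eq3 d(3) using factors by (intro partial_fractions)
  qed
qed

text \<open>The q-Pascal rule in base z^2 splits off the factor 1 + t z^(2n+1), because (i + 1)^2 +
  2 (n - i) = (2n + 1) + i^2.\<close>

lemma qbinomial_theorem:
  assumes "qfac (z\<^sup>2) n \<noteq> 0"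
  shows "(\<Sum>i\<le>n. t ^ i * z ^ (i\<^sup>2) * qbinom (z\<^sup>2) n i) = (\<Prod>j<n. 1 + t * z ^ (2 * j + 1))"
  using assms
proof (induction n)
  case 0
  then show ?case by (simp add: qbinom_def)
next
  case (Suc n)
  let ?b = "\<lambda>n i. t ^ i * z ^ (i\<^sup>2) * qbinom (z\<^sup>2) n i"
  have nz: "qfac (z\<^sup>2) n \<noteq> 0" using Suc.prems by (simp add: qfac_Suc)
  have step: "?b (Suc n) (Suc i) = ?b n (Suc i) + t * z ^ (2 * n + 1) * ?b n i" if "i \<le> n" for i
  proof -
    have "(Suc i)\<^sup>2 + 2 * (n - i) = 2 * n + 1 + i\<^sup>2"
      using that by (simp add: power2_eq_square diff_mult_distrib2)
    then have "z ^ ((Suc i)\<^sup>2) * (z\<^sup>2) ^ (n - i) = z ^ (2 * n + 1) * z ^ (i\<^sup>2)"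
      by (simp only: power_mult[symmetric] power_add[symmetric])
    then have "t ^ Suc i * (z ^ ((Suc i)\<^sup>2) * (z\<^sup>2) ^ (n - i)) * qbinom (z\<^sup>2) n i
        = t * z ^ (2 * n + 1) * ?b n i"
      by (simp add: mult_ac)
    then show ?thesis
      unfolding qbinom_Suc_Suc[OF Suc.prems that] by (simp only: algebra_simps)
  qed
  have "(\<Sum>i\<le>Suc n. ?b (Suc n) i) = ?b (Suc n) 0 + (\<Sum>i\<le>n. ?b (Suc n) (Suc i))"
    by (rule sum.atMost_Suc_shift)
  also have "(\<Sum>i\<le>n. ?b (Suc n) (Suc i)) = (\<Sum>i\<le>n. ?b n (Suc i)) + t * z ^ (2 * n + 1) * (\<Sum>i\<le>n. ?b n i)"
    unfolding sum_distrib_left sum.distrib[symmetric]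
    by (rule sum.cong) (simp_all only: atMost_iff step)
  also have "?b (Suc n) 0 = ?b n 0" using Suc.prems nz by (simp add: qbinom_def)
  also have "?b n 0 + ((\<Sum>i\<le>n. ?b n (Suc i)) + t * z ^ (2 * n + 1) * (\<Sum>i\<le>n. ?b n i))
      = (\<Sum>i\<le>Suc n. ?b n i) + t * z ^ (2 * n + 1) * (\<Sum>i\<le>n. ?b n i)"
    unfolding sum.atMost_Suc_shift by simp
  also have "(\<Sum>i\<le>Suc n. ?b n i) = (\<Sum>i\<le>n. ?b n i)" by (simp add: qbinom_def)
  finally show ?case unfolding Suc.IH[OF nz] by (simp add: algebra_simps)
qed

section \<open>Roots of unity of odd order\<close>

context
  fixes z :: "'a :: field" and N :: nat
  assumes root: "z ^ (2 * N + 1) = 1"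
    and primitive: "\<And>k. 0 < k \<Longrightarrow> k \<le> 2 * N \<Longrightarrow> z ^ k \<noteq> 1"
begin

lemma root_of_unity_shift: "z ^ (2 * N + 1 + k) = z ^ k"
  by (simp only: power_add[of _ "2 * N + 1"] root mult_1)

lemma qfac_square_nonzero: "k \<le> N \<Longrightarrow> qfac (z\<^sup>2) k \<noteq> 0"
  by (rule qfac_nonzero) (simp add: primitive flip: power_mult)

lemma odd_product_nonzero: "m \<le> N \<Longrightarrow> (\<Prod>j<m. 1 - z ^ (2 * j + 1)) \<noteq> 0"
  using primitive by (auto simp del: power_Suc)

text \<open>Past N, the even exponents 2 (N + j + 1) reduce modulo 2N + 1 to the odd numbers 2j +
  1.\<close>

lemma qfac_square_add: "qfac (z\<^sup>2) (N + m) = qfac (z\<^sup>2) N * (\<Prod>j<m. 1 - z ^ (2 * j + 1))"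
proof (induction m)
  case (Suc m)
  have "(z\<^sup>2) ^ Suc (N + m) = z ^ (2 * N + 1 + (2 * m + 1))"
    by (simp only: power_mult[symmetric]) (simp add: algebra_simps)
  then have "(z\<^sup>2) ^ Suc (N + m) = z ^ (2 * m + 1)" by (simp only: root_of_unity_shift)
  then have "qfac (z\<^sup>2) (Suc (N + m)) = qfac (z\<^sup>2) (N + m) * (1 - z ^ (2 * m + 1))"
    by (simp only: qfac_Suc)
  then show ?case using Suc by simp
qed simp

text \<open>With m = N - i, the product of 1 - z^(2j+1) over j < m occurs in the numerator by
  \<open>qfac_square_add\<close> and in the denominator by \<open>qfac_even\<close>, and
  cancels.\<close>

lemma pell_summand_root_of_unity:
  assumes "i \<le> N"
  shows "pell_summand t z (2 * N) i = t ^ i * z ^ (i\<^sup>2) * qbinom (z\<^sup>2) N i"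
proof -
  obtain m where N: "N = m + i" using assms by (metis le_add_diff_inverse2)
  have "qfac (z\<^sup>2) (2 * m + i) = qfac (z\<^sup>2) N * (\<Prod>j<m. 1 - z ^ (2 * j + 1))"
    using qfac_square_add[of m] N by (simp add: mult_2 add_ac)
  moreover have "(\<Prod>j<m. 1 - z ^ (2 * j + 1)) \<noteq> 0" by (rule odd_product_nonzero) (simp add: N)
  moreover have "2 * N - 2 * i = 2 * m" using N by simp
  ultimately show ?thesis
    using N assms by (simp add: pell_summand_def pell_term_def qbinom_def qfac_even)
qed

context
  fixes X :: "nat \<Rightarrow> 'a" and t :: 'a
  assumes X: "X 0 = 0" "X 1 = 1"
    "\<And>n. X (Suc (Suc n)) = (1 + z ^ (n + 1)) * X (Suc n) + t * z ^ n * X n"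
begin

lemma pell_root_of_unity: "X (2 * N + 1) = (\<Prod>j<N. 1 + t * z ^ (2 * j + 1))"
proof -
  have "X (Suc (2 * N)) = (\<Sum>i\<le>2 * N. pell_summand t z (2 * N) i)"
    by (rule pell_explicit[of X, OF X]) (rule primitive)
  also have "\<dots> = (\<Sum>i\<le>N. pell_summand t z (2 * N) i)"
    by (rule sum.mono_neutral_right) (auto simp: pell_summand_def)
  also have "\<dots> = (\<Sum>i\<le>N. t ^ i * z ^ (i\<^sup>2) * qbinom (z\<^sup>2) N i)"
    by (rule sum.cong) (simp_all add: pell_summand_root_of_unity)
  finally show ?thesis using qbinomial_theorem[OF qfac_square_nonzero[of N]] by simp
qed

text \<open>All summands of \<open>X (2 * N + 1)\<close> but the first cancel those of \<open>t * z ^ (2 * N) * X (2 * N)\<close>,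
  since going from \<open>m\<close> to \<open>m + 1\<close> multiplies \<open>pell_term t z m i\<close> by a factor \<open>1\<close> when
  \<open>m + 2 * i = 2 * N\<close>.\<close>

lemma pell_diff_root_of_unity:
  assumes "N > 0"
  shows "X (2 * N + 2) - X (2 * N + 1) = 1"
proof -
  obtain M where M: "2 * N = Suc M" using assms by (cases "2 * N") auto
  have cancel: "pell_summand t z (Suc M) (Suc i) = - (t * z ^ (2 * N) * pell_summand t z M i)" for i
  proof (cases "i < N")
    case False
    then show ?thesis using M by (simp add: pell_summand_def)
  next
    case True
    then obtain m where m: "2 * N = m + 2 * i + 2"
      using less_iff_Suc_add[of i N] by auto
    have nz: "z ^ Suc m \<noteq> 1" "(z\<^sup>2) ^ Suc i \<noteq> 1"
      unfolding power_mult[symmetric] by (rule primitive; use m in simp)+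
    have "z ^ (2 * (m + Suc i + 1)) = z ^ (2 * N + 1 + Suc m)"
      using m by (simp add: algebra_simps)
    also have "\<dots> = z ^ Suc m" by (rule root_of_unity_shift)
    finally have "pell_term t z (Suc m) (Suc i) = pell_term t z m (Suc i)"
      using pell_term_Suc_left[OF nz(1), of t "Suc i"] nz by (simp del: power_Suc)
    \<comment> \<open>As m + 2i + 3 = 2N + 1, the coefficient in \<open>pell_term_Suc\<close> is 2.
      Its left side equals the term so doubled, which leaves a sum equal to 0.\<close>
    moreover have "z ^ (m + 2 * i + 3) = 1" using root m by (simp add: numeral_3_eq_3)
    ultimately have "pell_term t z m (Suc i) = - (t * z ^ (2 * N) * pell_term t z (Suc m) i)"
      using pell_term_Suc[OF nz, of t] m by (simp add: algebra_simps add_eq_0_iff)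
    moreover have "Suc M - 2 * Suc i = m" "M - 2 * i = Suc m" using M m by simp_all
    ultimately show ?thesis using M m by (simp add: pell_summand_def)
  qed
  have first: "pell_summand t z (Suc M) 0 = 1"
    using pell_summand_root_of_unity[of 0 t] M qfac_square_nonzero[of N] by (simp add: qbinom_def)
  have "X (Suc (2 * N)) = (\<Sum>i\<le>Suc M. pell_summand t z (Suc M) i)"
    unfolding M[symmetric] by (rule pell_explicit[of X, OF X]) (rule primitive)
  also have "\<dots> = 1 - t * z ^ (2 * N) * (\<Sum>i\<le>M. pell_summand t z M i)"
    by (subst sum.atMost_Suc_shift) (simp only: first cancel sum_negf sum_distrib_left diff_conv_add_uminus)
  also have "(\<Sum>i\<le>M. pell_summand t z M i) = X (Suc M)"
    by (rule pell_explicit[of X, OF X, symmetric]) (simp add: M primitive)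
  finally have "X (Suc (2 * N)) + t * z ^ (2 * N) * X (2 * N) = 1" using M by simp
  \<comment> \<open>Removing one of the two copies of X (2N + 1) leaves the expression just shown to
    be 1.\<close>
  moreover have "X (Suc (Suc (2 * N))) = 2 * X (Suc (2 * N)) + t * z ^ (2 * N) * X (2 * N)"
    using X(3)[of "2 * N"] unfolding root by simp
  ultimately show ?thesis by (simp add: algebra_simps)
qed

end

text \<open>Modulo 2N + 1 the odd exponents 1, ..., 2N - 1 are the negatives of 2N, ..., 2, and (1 +
  z^(-k)) z^k = 1 + z^k. This reduces t = 1 to the product for t = z.\<close>

lemma prod_odd_exponents:
  "(\<Prod>j<N. 1 + z ^ (2 * j + 1)) * z ^ (2 * (\<Sum>j<N. Suc j)) = (\<Prod>j<N. 1 + z ^ (2 * Suc j))"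
proof -
  have "(1 + z ^ (2 * (N - Suc j) + 1)) * z ^ (2 * Suc j) = 1 + z ^ (2 * Suc j)" if "j < N" for j
  proof -
    have "2 * (N - Suc j) + 1 + 2 * Suc j = 2 * N + 1" using that by simp
    then have "z ^ (2 * (N - Suc j) + 1) * z ^ (2 * Suc j) = 1"
      by (simp only: power_add[symmetric] root)
    then show ?thesis by (simp only: distrib_right mult_1) (simp add: add.commute)
  qed
  then have "(\<Prod>j<N. 1 + z ^ (2 * Suc j))
      = (\<Prod>j<N. 1 + z ^ (2 * (N - Suc j) + 1)) * (\<Prod>j<N. z ^ (2 * Suc j))"
    unfolding prod.distrib[symmetric] by (intro prod.cong) simp_all
  also have "(\<Prod>j<N. 1 + z ^ (2 * (N - Suc j) + 1)) = (\<Prod>j<N. 1 + z ^ (2 * j + 1))"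
    by (rule prod.nat_diff_reindex)
  also have "(\<Prod>j<N. z ^ (2 * Suc j)) = z ^ (2 * (\<Sum>j<N. Suc j))"
    by (simp only: power_sum sum_distrib_left)
  finally show ?thesis by simp
qed

end

section \<open>Gauss's lemma for odd periodic functions\<close>

text \<open>The argument of Gauss's lemma carried out on values of \<open>f\<close>: reduction
  modulo p preserves them, and reflecting a residue above p/2 costs a sign, giving
  \<open>card E\<close> signs in total.\<close>

lemma (in GAUSS) prod_odd_periodic:
  fixes f :: "int \<Rightarrow> 'b :: comm_ring_1"
  assumes odd: "\<And>x. f (- x) = - f x" and periodic: "\<And>x. f (x mod int p) = f x"
  shows "(\<Prod>x\<in>A. f (x * a)) = of_int (Legendre a p) * (\<Prod>x\<in>A. f x)"
proof -
  have neg: "f (int p - x) = - f x" for x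
    using periodic[of "int p - x"] periodic[of "- x"] odd[of x] by simp
  have "(\<Prod>x\<in>A. f (x * a)) = (\<Prod>x\<in>B. f x)"
    unfolding B_def by (simp add: prod.reindex inj_on_xa_A)
  also have "\<dots> = (\<Prod>x\<in>C. f x)"
    unfolding C_def by (simp add: prod.reindex SR_B_inj periodic)
  also have "\<dots> = (\<Prod>x\<in>D. f x) * (\<Prod>x\<in>E. f x)"
    unfolding C_eq by (rule prod.union_disjoint) (auto simp: finite_D finite_E D_E_disj)
  also have "(\<Prod>x\<in>E. f x) = (\<Prod>x\<in>E. - f (int p - x))"
    by (simp add: neg)
  also have "\<dots> = (- 1) ^ card E * (\<Prod>x\<in>E. f (int p - x))"
    by (rule prod_uminus)
  also have "(\<Prod>x\<in>E. f (int p - x)) = (\<Prod>x\<in>F. f x)"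
    unfolding F_def by (simp add: prod.reindex)
  also have "(\<Prod>x\<in>D. f x) * ((- 1) ^ card E * (\<Prod>x\<in>F. f x))
      = (- 1) ^ card E * ((\<Prod>x\<in>F. f x) * (\<Prod>x\<in>D. f x))"
    by (simp add: mult_ac)
  also have "(\<Prod>x\<in>F. f x) * (\<Prod>x\<in>D. f x) = (\<Prod>x\<in>A. f x)"
    unfolding F_Un_D_eq_A[symmetric]
    by (rule prod.union_disjoint[symmetric]) (auto simp: finite_D finite_F F_D_disj)
  finally show ?thesis by (simp add: gauss_lemma)
qed

text \<open>The function \<open>f x = z ^ x - z ^ (- x)\<close> is odd and periodic, and
  \<open>f (2 * x) / f x = z ^ x + z ^ (- x)\<close>.\<close>

lemma prod_even_exponents:
  fixes z :: "'a :: field"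
  assumes "prime p" and p: "p = 2 * N + 1" and root: "z ^ p = 1" and "z \<noteq> 1"
  shows "(\<Prod>j<N. 1 + z ^ (2 * Suc j)) = of_int (Legendre 2 (int p)) * z ^ (\<Sum>j<N. Suc j)"
proof -
  have "p > 2" using \<open>prime p\<close> p prime_gt_1_nat[of p] by (cases N) auto
  interpret GAUSS p 2
    using \<open>prime p\<close> \<open>p > 2\<close> by unfold_locales (auto simp: cong_def)
  have z0: "z \<noteq> 0" using root \<open>p > 2\<close> by (auto simp: power_0_left)
  define f where "f x = z powi x - z powi (- x)" for x
  have mod: "z powi (x mod int p) = z powi x" for x
  proof -
    have "z powi x = z powi (int p * (x div int p) + x mod int p)" by simp
    also have "\<dots> = (z powi int p) powi (x div int p) * z powi (x mod int p)"
      using z0 by (simp only: power_int_add power_int_mult simp_thms)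
    finally show ?thesis by (simp add: root)
  qed
  have "f (x mod int p) = f x" for x
    unfolding f_def power_int_minus mod by (rule refl)
  then have gauss: "(\<Prod>x\<in>A. f (x * 2)) = of_int (Legendre 2 (int p)) * (\<Prod>x\<in>A. f x)"
    by (intro prod_odd_periodic) (simp_all add: f_def)
  have A: "A = (\<lambda>j. int (Suc j)) ` {..<N}"
  proof (intro equalityI subsetI)
    fix x assume "x \<in> A"
    then have "0 < x" "x \<le> int N" unfolding A_def by (simp_all add: p)
    then have "x = int (Suc (nat x - 1))" "nat x - 1 < N" by auto
    then show "x \<in> (\<lambda>j. int (Suc j)) ` {..<N}" by blast
  qed (auto simp: A_def, simp add: p)
  have reindex: "(\<Prod>x\<in>A. h x) = (\<Prod>j<N. h (int (Suc j)))" for h :: "int \<Rightarrow> 'a"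
    unfolding A by (subst prod.reindex) (auto simp: inj_on_def)
  have f: "f (int k) * z ^ k = z ^ (2 * k) - 1" for k
    using z0 by (simp only: f_def power_int_minus power_int_of_nat mult_2 power_add) (simp add: left_diff_distrib)
  have double: "f (int k * 2) * z ^ k = f (int k) * (1 + z ^ (2 * k))" for k
  proof -
    have "f (int k * 2) * z ^ (2 * k) = z ^ (2 * k) * z ^ (2 * k) - 1"
      using f[of "2 * k"] unfolding mult_2[of "2 * k"] power_add by (simp add: mult.commute[of "int k"])
    also have "\<dots> = (z ^ (2 * k) - 1) * (1 + z ^ (2 * k))"
      by (simp add: algebra_simps)
    also have "\<dots> = f (int k) * (1 + z ^ (2 * k)) * z ^ k"
      unfolding f[of k, symmetric] by (simp add: mult_ac)
    finally have "(f (int k * 2) * z ^ k) * z ^ k = f (int k) * (1 + z ^ (2 * k)) * z ^ k"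
      by (simp only: mult_2[of k] power_add mult.assoc)
    then show ?thesis using z0 by simp
  qed
  have nz: "(\<Prod>j<N. f (int (Suc j))) \<noteq> 0"
  proof -
    have "f (int (Suc j)) \<noteq> 0" if "j < N" for j
    proof -
      have "z ^ (2 * Suc j) \<noteq> 1"
        by (rule prime_root_of_unity_power_neq_1[OF \<open>prime p\<close> root \<open>z \<noteq> 1\<close>]) (use that p in auto)
      then show ?thesis using f[of "Suc j"] by auto
    qed
    then show ?thesis by simp
  qed
  \<comment> \<open>Multiply \<open>double\<close> over all j; by \<open>gauss\<close> the doubled
    arguments change the product of \<open>f\<close> only by the Legendre symbol, and that product
    cancels by \<open>nz\<close>.\<close>
  have "(\<Prod>j<N. f (int (Suc j))) * (\<Prod>j<N. 1 + z ^ (2 * Suc j))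
      = (\<Prod>j<N. f (int (Suc j) * 2)) * (\<Prod>j<N. z ^ Suc j)"
    unfolding prod.distrib[symmetric] double by (rule refl)
  also have "\<dots> = (\<Prod>j<N. f (int (Suc j))) * (of_int (Legendre 2 (int p)) * z ^ (\<Sum>j<N. Suc j))"
    using gauss by (simp only: reindex power_sum mult_ac)
  finally show ?thesis using nz by simp
qed

section \<open>From values at roots of unity to congruences in Z[q]\<close>

theorem theorem1p3:
  fixes p :: nat
  assumes "prime p" and "odd p"
  shows "[q ^ ((p\<^sup>2 - 1) div 8) * q_pell p \<equiv> of_int (Legendre 2 (int p))] (pmod q_bracket p)
    \<and> [q_pell_hat p \<equiv> of_int (Legendre 2 (int p)) * q ^ ((p\<^sup>2 - 1) div 8)] (pmod q_bracket p)
    \<and> [q_pell (p + 1) - q_pell p \<equiv> q_pell_hat (p + 1) - q_pell_hat p] (pmod q_bracket p)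
    \<and> [q_pell_hat (p + 1) - q_pell_hat p \<equiv> 1] (pmod q_bracket p)"
proof -
  obtain N where N: "p = 2 * N + 1" using \<open>odd p\<close> by (rule oddE)
  have "N > 0" using \<open>prime p\<close> N by (cases N) auto
  \<comment> \<open>The triangular number N (N + 1) / 2, which is (p^2 - 1) / 8.\<close>
  define e where "e = (\<Sum>j<N. Suc j)"
  have "2 * e = N * (N + 1)" unfolding e_def by (induction N) simp_all
  moreover have "p\<^sup>2 - 1 = 4 * (N * (N + 1))" by (simp add: N power2_eq_square)
  ultimately have e: "(p\<^sup>2 - 1) div 8 = e" by simp
  let ?L = "of_int (Legendre 2 (int p)) :: complex"
  have main: "z ^ e * eval_complex z (q_pell p) = ?L"
      "eval_complex z (q_pell_hat p) = ?L * z ^ e"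
      "eval_complex z (q_pell (Suc p)) - eval_complex z (q_pell p) = 1"
      "eval_complex z (q_pell_hat (Suc p)) - eval_complex z (q_pell_hat p) = 1"
    if z: "z ^ p = 1" "z \<noteq> 1" for z
  proof -
    have root: "z ^ (2 * N + 1) = 1" using z N by simp
    have primitive: "z ^ k \<noteq> 1" if "0 < k" "k \<le> 2 * N" for k
      by (rule prime_root_of_unity_power_neq_1[OF \<open>prime p\<close> z]) (use that N in auto)
    have z0: "z \<noteq> 0" using root by (auto simp: power_0_left)
    have even: "(\<Prod>j<N. 1 + z ^ (2 * Suc j)) = ?L * z ^ e"
      unfolding e_def by (rule prod_even_exponents[OF \<open>prime p\<close> N z])
    have odd: "(\<Prod>j<N. 1 + z ^ (2 * j + 1)) * z ^ (2 * e) = ?L * z ^ e"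
      using prod_odd_exponents[of z N, OF root primitive] even by (simp only: e_def)
    let ?X = "\<lambda>n. eval_complex z (q_pell n)" and ?Y = "\<lambda>n. eval_complex z (q_pell_hat n)"
    \<comment> \<open>The factor 1 exhibits t = 1; in \<open>Y\<close>, writing z^(n+1) as z times
      z^n exhibits t = z.\<close>
    have X: "?X 0 = 0" "?X 1 = 1"
        "?X (Suc (Suc n)) = (1 + z ^ (n + 1)) * ?X (Suc n) + 1 * z ^ n * ?X n" for n
      by simp_all
    have Y: "?Y 0 = 0" "?Y 1 = 1"
        "?Y (Suc (Suc n)) = (1 + z ^ (n + 1)) * ?Y (Suc n) + z * z ^ n * ?Y n" for n
      by simp_all
    have Xp: "?X p = (\<Prod>j<N. 1 + z ^ (2 * j + 1))"
      using pell_root_of_unity[of z N ?X, OF root primitive X] N by simp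
    have "(z ^ e * ?X p) * z ^ e = ?L * z ^ e"
      unfolding Xp odd[symmetric] mult_2[of e] power_add by (simp only: mult_ac)
    then show "z ^ e * ?X p = ?L" using z0 by simp
    show "?Y p = ?L * z ^ e"
      using pell_root_of_unity[of z N ?Y, OF root primitive Y] N even by simp
    show "?X (Suc p) - ?X p = 1"
      using pell_diff_root_of_unity[of z N ?X, OF root primitive X \<open>N > 0\<close>] N by simp
    show "?Y (Suc p) - ?Y p = 1"
      using pell_diff_root_of_unity[of z N ?Y, OF root primitive Y \<open>N > 0\<close>] N by simp
  qed
  have "p > 0" using N by simp
  show ?thesis
    unfolding poly_cong_def e
    by (intro conjI q_bracket_dvd[OF \<open>p > 0\<close>]; simp add: main(1) main(3,4); simp add: main(2))
qed

end
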